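(* Let $G$ be a finite set of finite sets, with constant energy $h(x)=1$ for all $x\in G$. Then the multigraphs $\Gamma^{--}$ and $\Gamma^{++}$ with vertex set $G$ defined by the adjacency matrices $L^{--}$ and $L^{++}$ respectively are isospectral, i.e. the matrices $L^{--}$ and $L^{++}$ have the same eigenvalues with the same multiplicities.
   Context: For $x\in G$ let $W^+(x)=\{y\in G: x\subset y\}$ and $W^-(x)=\{y\in G: y\subset x\}$ (both include $x$). For $A\subset G$ put $E[A]=\sum_{x\in A}h(x)$, which for $h=1$ is the cardinality of $A$. The matrices, indexed by $G\times G$, are $L^{--}(x,y)=E[W^-(x)\cap W^-(y)]$ and $L^{++}(x,y)=E[W^+(x)\cap W^+(y)]$. The multigraph $\Gamma^{--}$ (respectively $\Gamma^{++}$) has the elements of $G$ as nodes and has exactly $L^{--}(x,y)$ (respectively $L^{++}(x,y)$) connections from $x$ to $y$ (including loops when $x=y$). No closure property of $G$ under subsets is assumed. *)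

theory Defs
  imports
    "Jordan_Normal_Form.Spectral_Radius"
    "Graph_Theory.Digraph"
begin

definition W_plus :: "'a set set \<Rightarrow> 'a set \<Rightarrow> 'a set set" where
  "W_plus G x = {y \<in> G. x \<subseteq> y}"

definition W_minus :: "'a set set \<Rightarrow> 'a set \<Rightarrow> 'a set set" where
  "W_minus G x = {y \<in> G. y \<subseteq> x}"

definition energy :: "('a set \<Rightarrow> 'b::comm_monoid_add) \<Rightarrow> 'a set set \<Rightarrow> 'b" where
  "energy h A = (\<Sum>x\<in>A. h x)"

definition L_minus_minus ::
    "'a set set \<Rightarrow> ('a set \<Rightarrow> 'b::comm_monoid_add) \<Rightarrow> 'a set \<Rightarrow> 'a set \<Rightarrow> 'b" where
  "L_minus_minus G h x y = energy h (W_minus G x \<inter> W_minus G y)"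

definition L_plus_plus ::
    "'a set set \<Rightarrow> ('a set \<Rightarrow> 'b::comm_monoid_add) \<Rightarrow> 'a set \<Rightarrow> 'a set \<Rightarrow> 'b" where
  "L_plus_plus G h x y = energy h (W_plus G x \<inter> W_plus G y)"

(* A matrix indexed by a finite set V is turned into a library matrix by means of an
   enumeration xs of V (a duplicate-free list with set V), used for rows and columns alike. *)

definition enumerates :: "'i list \<Rightarrow> 'i set \<Rightarrow> bool" where
  "enumerates xs V \<longleftrightarrow> distinct xs \<and> set xs = V"

definition indexed_mat :: "'i list \<Rightarrow> ('i \<Rightarrow> 'i \<Rightarrow> 'b) \<Rightarrow> 'b mat" where
  "indexed_mat xs M = mat (length xs) (length xs) (\<lambda>(i, j). M (xs ! i) (xs ! j))"

definition same_spectrum :: "complex mat \<Rightarrow> complex mat \<Rightarrow> bool" where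
  "same_spectrum A B \<longleftrightarrow>
     spectrum A = spectrum B \<and>
     (\<forall>k \<in> spectrum A. order k (char_poly A) = order k (char_poly B))"

(* An undirected multigraph is encoded as a symmetric multi-digraph: the k-th connection from x
   to y is the arc (x, y, k), so the connection matrix m, loops included, is exactly the
   adjacency matrix. *)

definition multigraph :: "'v set \<Rightarrow> ('v \<Rightarrow> 'v \<Rightarrow> nat) \<Rightarrow> ('v, 'v \<times> 'v \<times> nat) pre_digraph" where
  "multigraph V m =
     \<lparr> verts = V,
       arcs = {(x, y, k). x \<in> V \<and> y \<in> V \<and> k < m x y},
       tail = (\<lambda>(x, y, k). x),
       head = (\<lambda>(x, y, k). y) \<rparr>"

definition Gamma_minus_minus ::
    "'a set set \<Rightarrow> ('a set \<Rightarrow> nat) \<Rightarrow> ('a set, 'a set \<times> 'a set \<times> nat) pre_digraph" where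
  "Gamma_minus_minus G h = multigraph G (L_minus_minus G h)"

definition Gamma_plus_plus ::
    "'a set set \<Rightarrow> ('a set \<Rightarrow> nat) \<Rightarrow> ('a set, 'a set \<times> 'a set \<times> nat) pre_digraph" where
  "Gamma_plus_plus G h = multigraph G (L_plus_plus G h)"

definition adjacency :: "('v, 'e) pre_digraph \<Rightarrow> 'v \<Rightarrow> 'v \<Rightarrow> nat" where
  "adjacency \<Gamma> x y = card {e \<in> arcs \<Gamma>. tail \<Gamma> e = x \<and> head \<Gamma> e = y}"

definition isospectral :: "('v, 'e) pre_digraph \<Rightarrow> ('w, 'f) pre_digraph \<Rightarrow> bool" where
  "isospectral \<Gamma> \<Delta> \<longleftrightarrow>
     fin_digraph \<Gamma> \<and> fin_digraph \<Delta> \<and>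
     (\<forall>xs ys. enumerates xs (verts \<Gamma>) \<longrightarrow> enumerates ys (verts \<Delta>) \<longrightarrow>
        same_spectrum
          (indexed_mat xs (\<lambda>x y. of_nat (adjacency \<Gamma> x y)))
          (indexed_mat ys (\<lambda>x y. of_nat (adjacency \<Delta> x y))))"

lemma L_minus_minus_commute: "L_minus_minus G h x y = L_minus_minus G h y x"
  by (simp add: L_minus_minus_def Int_commute)

lemma L_plus_plus_commute: "L_plus_plus G h x y = L_plus_plus G h y x"
  by (simp add: L_plus_plus_def Int_commute)

lemma adjacency_multigraph:
  assumes "x \<in> V" "y \<in> V"
  shows "adjacency (multigraph V m) x y = m x y"
proof -
  have "{e \<in> arcs (multigraph V m). tail (multigraph V m) e = x \<and> head (multigraph V m) e = y}
          = (\<lambda>k. (x, y, k)) ` {..<m x y}"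
    using assms by (auto simp: multigraph_def)
  then show ?thesis
    by (simp add: adjacency_def card_image inj_on_def)
qed

lemma fin_digraph_multigraph:
  assumes "finite V"
  shows "fin_digraph (multigraph V m)"
proof
  have "arcs (multigraph V m) = (\<Union>x\<in>V. \<Union>y\<in>V. (\<lambda>k. (x, y, k)) ` {..<m x y})"
    by (auto simp: multigraph_def)
  then show "finite (arcs (multigraph V m))"
    using assms by simp
qed (use assms in \<open>auto simp: multigraph_def\<close>)

end

theory Submission
  imports Defs
begin

text \<open>
  Let \<open>Z\<close> be the incidence matrix of inclusion on \<open>G\<close>, with entry 1 at \<open>(x, z)\<close> if \<open>z \<subseteq> x\<close> and 0
  otherwise. With unit energies, the \<open>(x, y)\<close> entry of \<open>L\<^sup>-\<^sup>-\<close> counts the common lower neighbours of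
  \<open>x\<close> and \<open>y\<close>, so it is the inner product of two rows of \<open>Z\<close>; likewise \<open>L\<^sup>+\<^sup>+\<close> counts common upper
  neighbours and collects the inner products of the columns. Hence \<open>L\<^sup>-\<^sup>- = Z Z\<^sup>T\<close> and
  \<open>L\<^sup>+\<^sup>+ = Z\<^sup>T Z\<close>, and the theorem is an instance of the fact that \<open>A B\<close> and \<open>B A\<close> have the same
  characteristic polynomial when both are square of the same size (\<open>char_poly_mult_commute\<close>).

  Rows and columns of \<open>Z\<close> may be listed in different orders: listing rows by \<open>xs\<close> and columns by
  \<open>ys\<close> gives \<open>L\<^sup>-\<^sup>-\<close> in the order \<open>xs\<close> and \<open>L\<^sup>+\<^sup>+\<close> in the order \<open>ys\<close>. This takes care of
  arbitrary enumerations of the two vertex sets without any permutation of matrices.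
\<close>

lemma char_poly_four_block_lower_triangular:
  fixes A :: "'a :: idom mat"
  assumes A: "A \<in> carrier_mat n n" and C: "C \<in> carrier_mat m n" and D: "D \<in> carrier_mat m m"
  shows "char_poly (four_block_mat A (0\<^sub>m n m) C D) = char_poly A * char_poly D"
proof -
  have "char_poly_matrix (four_block_mat A (0\<^sub>m n m) C D)
      = four_block_mat (char_poly_matrix A) (0\<^sub>m n m) (map_mat (\<lambda>a. [:- a:]) C) (char_poly_matrix D)"
    using A C D unfolding char_poly_matrix_def by (intro eq_matI) auto
  then show ?thesis
    using A C D unfolding char_poly_def
    by (simp add: det_four_block_mat_upper_right_zero[of _ n _ m])
qed

lemma char_poly_zero_mat: "char_poly (0\<^sub>m n n :: 'a :: idom mat) = monom 1 n"
proof -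
  have "upper_triangular (0\<^sub>m n n :: 'a mat)"
    by auto
  then have "char_poly (0\<^sub>m n n :: 'a mat) = (\<Prod>a\<leftarrow>diag_mat (0\<^sub>m n n :: 'a mat). [:- a, 1:])"
    by (intro char_poly_upper_triangular[of _ n]) auto
  also have "diag_mat (0\<^sub>m n n :: 'a mat) = replicate n 0"
    by (auto simp: diag_mat_def intro: nth_equalityI)
  finally show ?thesis
    by (simp add: monom_altdef)
qed

text \<open>
  The matrices \<open>A B\<close> and \<open>B A\<close> need not be similar nor of equal size, but after padding with
  zeros they become diagonal blocks of two similar block triangular matrices: the unipotent matrix
  with upper right block \<open>A\<close> conjugates one into the other. The padding contributes a power of the
  indeterminate on each side.
\<close>

lemma char_poly_mult_commute_rectangular:
  fixes A B :: "'a :: idom mat"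
  assumes A: "A \<in> carrier_mat n m" and B: "B \<in> carrier_mat m n"
  shows "char_poly (A * B) * monom 1 m = monom 1 n * char_poly (B * A)"
proof -
  define M where "M = four_block_mat (A * B) (0\<^sub>m n m) B (0\<^sub>m m m)"
  define N where "N = four_block_mat (0\<^sub>m n n) (0\<^sub>m n m) B (B * A)"
  define S where "S = four_block_mat (1\<^sub>m n) A (0\<^sub>m m n) (1\<^sub>m m)"
  define T where "T = four_block_mat (1\<^sub>m n) (- A) (0\<^sub>m m n) (1\<^sub>m m)"
  have carrier: "{M, N, S, T} \<subseteq> carrier_mat (n + m) (n + m)"
    using A B by (simp add: M_def N_def S_def T_def)
  note block_mult = mult_four_block_mat[where ?nr1.0 = n and ?n1.0 = n and ?n2.0 = m and ?nr2.0 = m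
      and ?nc1.0 = n and ?nc2.0 = m]
  have AA: "A + - A = 0\<^sub>m n m" "- A + A = 0\<^sub>m n m" "- 0\<^sub>m m m = (0\<^sub>m m m :: 'a mat)"
    using A by auto
  have ST: "S * T = 1\<^sub>m (n + m)"
    using A AA unfolding S_def T_def
    by (subst block_mult) auto
  have TS: "T * S = 1\<^sub>m (n + m)"
    using A AA unfolding S_def T_def
    by (subst block_mult) auto
  have MS: "M * S = four_block_mat (A * B) (A * B * A) B (B * A)"
    using A B unfolding M_def S_def
    by (subst block_mult) auto
  have SN: "S * N = four_block_mat (A * B) (A * B * A) B (B * A)"
    using A B unfolding N_def S_def
    by (subst block_mult) auto
  have "M = M * (S * T)"
    using carrier ST by auto
  also have "\<dots> = M * S * T"
    using carrier by (auto simp: assoc_mult_mat[of M "n + m" "n + m" S "n + m" T "n + m"])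
  also have "\<dots> = S * N * T"
    by (simp add: MS SN)
  finally have "similar_mat_wit M N S T"
    using carrier ST TS by (intro similar_mat_witI[of _ _ "n + m"]) auto
  then have "similar_mat M N"
    by (auto simp: similar_mat_def)
  then have "char_poly M = char_poly N"
    by (rule char_poly_similar)
  then show ?thesis
    using A B unfolding M_def N_def
    by (simp add: char_poly_four_block_lower_triangular char_poly_zero_mat)
qed

lemma char_poly_mult_commute:
  fixes A B :: "'a :: idom mat"
  assumes "A \<in> carrier_mat n n" "B \<in> carrier_mat n n"
  shows "char_poly (A * B) = char_poly (B * A)"
  using char_poly_mult_commute_rectangular[OF assms] by (simp add: mult.commute)

lemma same_spectrum_if_char_poly_eq:
  assumes "A \<in> carrier_mat n n" "B \<in> carrier_mat n n" "char_poly A = char_poly B"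
  shows "same_spectrum A B"
  using assms spectrum_root_char_poly unfolding same_spectrum_def by metis

lemma indexed_mat_cong:
  assumes "\<And>x y. x \<in> set xs \<Longrightarrow> y \<in> set xs \<Longrightarrow> M x y = N x y"
  shows "indexed_mat xs M = indexed_mat xs N"
  using assms by (auto simp: indexed_mat_def intro!: eq_matI)

text \<open>Separate lists for rows and columns let the two products with the transpose be indexed
  independently of each other.\<close>

definition inclusion_mat :: "'a set list \<Rightarrow> 'a set list \<Rightarrow> complex mat" where
  "inclusion_mat xs ys = mat (length xs) (length ys) (\<lambda>(i, j). of_bool (ys ! j \<subseteq> xs ! i))"

lemma of_nat_card_eq_sum_enumeration:
  assumes "enumerates zs G"
  shows "of_nat (card {z \<in> G. P z \<and> Q z})
    = (\<Sum>k<length zs. of_bool (P (zs ! k)) * of_bool (Q (zs ! k)) :: 'b :: semiring_1)"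
proof -
  have zs: "distinct zs" "set zs = G"
    using assms by (auto simp: enumerates_def)
  then have "finite G"
    by auto
  have "(of_nat (card {z \<in> G. P z \<and> Q z}) :: 'b) = (\<Sum>z\<in>G. of_bool (P z \<and> Q z))"
    using \<open>finite G\<close> by (simp add: Collect_conj_eq)
  also have "\<dots> = (\<Sum>k<length zs. of_bool (P (zs ! k) \<and> Q (zs ! k)))"
    using bij_betw_nth[OF zs(1) refl zs(2)[symmetric]]
    by (rule sum.reindex_bij_betw[symmetric])
  finally show ?thesis
    by (simp add: of_bool_conj)
qed

lemma L_minus_minus_unit_energy:
  fixes h :: "'a set \<Rightarrow> nat"
  assumes "\<And>x. x \<in> G \<Longrightarrow> h x = 1"
  shows "L_minus_minus G h x y = card {z \<in> G. z \<subseteq> x \<and> z \<subseteq> y}"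
proof -
  have "W_minus G x \<inter> W_minus G y = {z \<in> G. z \<subseteq> x \<and> z \<subseteq> y}"
    by (auto simp: W_minus_def)
  then show ?thesis
    using assms by (simp add: L_minus_minus_def energy_def)
qed

lemma L_plus_plus_unit_energy:
  fixes h :: "'a set \<Rightarrow> nat"
  assumes "\<And>x. x \<in> G \<Longrightarrow> h x = 1"
  shows "L_plus_plus G h x y = card {z \<in> G. x \<subseteq> z \<and> y \<subseteq> z}"
proof -
  have "W_plus G x \<inter> W_plus G y = {z \<in> G. x \<subseteq> z \<and> y \<subseteq> z}"
    by (auto simp: W_plus_def)
  then show ?thesis
    using assms by (simp add: L_plus_plus_def energy_def)
qed

lemma indexed_L_minus_minus_eq_mult_transpose:
  fixes h :: "'a set \<Rightarrow> nat"
  assumes "\<And>x. x \<in> G \<Longrightarrow> h x = 1" and "enumerates ys G"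
  shows "indexed_mat xs (\<lambda>x y. of_nat (L_minus_minus G h x y))
    = inclusion_mat xs ys * transpose_mat (inclusion_mat xs ys)"
  by (rule eq_matI)
    (auto simp: indexed_mat_def inclusion_mat_def scalar_prod_def L_minus_minus_unit_energy[OF assms(1)]
      of_nat_card_eq_sum_enumeration[OF assms(2)] lessThan_atLeast0)

lemma indexed_L_plus_plus_eq_transpose_mult:
  fixes h :: "'a set \<Rightarrow> nat"
  assumes "\<And>x. x \<in> G \<Longrightarrow> h x = 1" and "enumerates xs G"
  shows "indexed_mat ys (\<lambda>x y. of_nat (L_plus_plus G h x y))
    = transpose_mat (inclusion_mat xs ys) * inclusion_mat xs ys"
  by (rule eq_matI)
    (auto simp: indexed_mat_def inclusion_mat_def scalar_prod_def L_plus_plus_unit_energy[OF assms(1)]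
      of_nat_card_eq_sum_enumeration[OF assms(2)] lessThan_atLeast0)

lemma same_spectrum_L_minus_minus_L_plus_plus:
  fixes h :: "'a set \<Rightarrow> nat"
  assumes h: "\<And>x. x \<in> G \<Longrightarrow> h x = 1" and xs: "enumerates xs G" and ys: "enumerates ys G"
  shows "same_spectrum
      (indexed_mat xs (\<lambda>x y. of_nat (L_minus_minus G h x y)))
      (indexed_mat ys (\<lambda>x y. of_nat (L_plus_plus G h x y)))"
proof -
  define Z where "Z = inclusion_mat xs ys"
  \<comment> \<open>Both lists enumerate \<open>G\<close>, so \<open>Z\<close> is square.\<close>
  have "length ys = length xs"
    using xs ys by (metis enumerates_def distinct_card)
  then have Z: "Z \<in> carrier_mat (length xs) (length xs)"
    by (simp add: Z_def inclusion_mat_def)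
  have "same_spectrum (Z * transpose_mat Z) (transpose_mat Z * Z)"
    using Z
    by (intro same_spectrum_if_char_poly_eq[of _ "length xs"] char_poly_mult_commute[of _ "length xs"]) auto
  then show ?thesis
    by (simp add: Z_def indexed_L_minus_minus_eq_mult_transpose[OF h ys]
        indexed_L_plus_plus_eq_transpose_mult[OF h xs])
qed

lemma indexed_mat_adjacency_multigraph:
  assumes "enumerates xs V"
  shows "indexed_mat xs (\<lambda>x y. of_nat (adjacency (multigraph V m) x y))
    = indexed_mat xs (\<lambda>x y. of_nat (m x y))"
  using assms by (intro indexed_mat_cong) (simp add: enumerates_def adjacency_multigraph)

theorem corollary5:
  fixes G :: "'a set set" and h :: "'a set \<Rightarrow> nat"
  assumes "finite G"
    and "\<And>x. x \<in> G \<Longrightarrow> finite x"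
    and "\<And>x. x \<in> G \<Longrightarrow> h x = 1"
  shows "isospectral (Gamma_minus_minus G h) (Gamma_plus_plus G h)
    \<and> (\<forall>xs ys. enumerates xs G \<longrightarrow> enumerates ys G \<longrightarrow>
         same_spectrum
           (indexed_mat xs (\<lambda>x y. of_nat (L_minus_minus G h x y)))
           (indexed_mat ys (\<lambda>x y. of_nat (L_plus_plus G h x y))))"
proof -
  have verts: "verts (multigraph G m) = G" for m
    by (simp add: multigraph_def)
  have "same_spectrum
      (indexed_mat xs (\<lambda>x y. of_nat (L_minus_minus G h x y)))
      (indexed_mat ys (\<lambda>x y. of_nat (L_plus_plus G h x y)))"
    if "enumerates xs G" "enumerates ys G" for xs ys
    using that assms(3) by (intro same_spectrum_L_minus_minus_L_plus_plus) auto
  then show ?thesis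
    using assms(1)
    by (simp add: isospectral_def Gamma_minus_minus_def Gamma_plus_plus_def verts
        fin_digraph_multigraph indexed_mat_adjacency_multigraph)
qed

end
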